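(* For any $\gamma>1$, there is an online algorithm for online sorting of $n$ items drawn independently and uniformly at random from $(0,1)$ into an array of size $\lceil\gamma n\rceil$ that achieves expected competitive ratio $O\!\left(1+\frac{1}{\gamma-1}\right)$.
   Context: Online sorting into a larger array: a sequence $x_1,\dots,x_n$ of reals is revealed one at a time; upon receiving $x_j$, an online algorithm must immediately and irrevocably write it into a previously empty cell of an array with $\lceil\gamma n\rceil$ cells. The cost of the final array is the sum of $|x-y|$ over all pairs of items $x,y$ occupying cells with no other item placed in a cell between them. The offline optimum is the minimum such cost over all placements. The expected competitive ratio compares the expected cost of the algorithm on the random input with the offline optimum cost. *)

theory Defs
  imports "HOL-Probability.Probability"
begin

definition placements :: "nat \<Rightarrow> nat \<Rightarrow> (nat \<Rightarrow> nat) set" where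
  "placements n m = {p \<in> {..<n} \<rightarrow>\<^sub>E {..<m}. inj_on p {..<n}}"

definition adjacent_items :: "nat \<Rightarrow> (nat \<Rightarrow> nat) \<Rightarrow> (nat \<times> nat) set" where
  "adjacent_items n p =
     {(i, j) \<in> {..<n} \<times> {..<n}. p i < p j \<and> \<not> (\<exists>k<n. p i < p k \<and> p k < p j)}"

definition placement_cost :: "nat \<Rightarrow> (nat \<Rightarrow> nat) \<Rightarrow> (nat \<Rightarrow> real) \<Rightarrow> real" where
  "placement_cost n p x = (\<Sum>(i, j) \<in> adjacent_items n p. \<bar>x i - x j\<bar>)"

definition offline_opt :: "nat \<Rightarrow> nat \<Rightarrow> (nat \<Rightarrow> real) \<Rightarrow> real" where
  "offline_opt n m x = Min ((\<lambda>p. placement_cost n p x) ` placements n m)"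

text \<open>A deterministic online algorithm is a map \<open>A\<close> from the nonempty list of all items revealed so
  far to the cell receiving the last of them; earlier cells are determined by the same list. The
  items are \<open>x 0, \<dots>, x (n - 1)\<close>.\<close>

definition online_placement :: "(real list \<Rightarrow> nat) \<Rightarrow> nat \<Rightarrow> (nat \<Rightarrow> real) \<Rightarrow> nat \<Rightarrow> nat" where
  "online_placement A n x = (\<lambda>j\<in>{..<n}. A (map x [0..<Suc j]))"

text \<open>Injectivity of the final placement says that every item is written into a cell that was
  still empty when it arrived.\<close>

definition online_sorting_algorithm :: "nat \<Rightarrow> nat \<Rightarrow> (real list \<Rightarrow> nat) \<Rightarrow> bool" where
  "online_sorting_algorithm n m A \<longleftrightarrow> (\<forall>x. online_placement A n x \<in> placements n m)"

definition online_cost :: "(real list \<Rightarrow> nat) \<Rightarrow> nat \<Rightarrow> (nat \<Rightarrow> real) \<Rightarrow> real" where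
  "online_cost A n x = placement_cost n (online_placement A n x) x"

definition uniform_items :: "nat \<Rightarrow> (nat \<Rightarrow> real) measure" where
  "uniform_items n = PiM {..<n} (\<lambda>_. uniform_measure lborel {0<..<1})"

text \<open>For random inputs the optimum is itself random, and an expected competitive ratio of at most
  \<open>R\<close> is understood in both customary senses: the expected cost is at most \<open>R\<close> times the
  expected optimum, and the expectation of the ratio of cost to optimum is at most \<open>R\<close>. The optimum
  is positive almost surely if \<open>n \<ge> 2\<close>; for \<open>n \<le> 1\<close> cost and optimum are both \<open>0\<close>. Integrability is
  demanded because the Bochner integral of a non-integrable function is \<open>0\<close>.\<close>

definition expected_competitive_ratio_le ::
    "nat \<Rightarrow> nat \<Rightarrow> (real list \<Rightarrow> nat) \<Rightarrow> real \<Rightarrow> bool" where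
  "expected_competitive_ratio_le n m A R \<longleftrightarrow>
     integrable (uniform_items n) (online_cost A n) \<and>
     integrable (uniform_items n) (offline_opt n m) \<and>
     integrable (uniform_items n) (\<lambda>x. online_cost A n x / offline_opt n m x) \<and>
     (\<integral>x. online_cost A n x \<partial>uniform_items n) \<le> R * (\<integral>x. offline_opt n m x \<partial>uniform_items n) \<and>
     (\<integral>x. online_cost A n x / offline_opt n m x \<partial>uniform_items n) \<le> R"

end

theory Submission imports Defs begin

text \<open>The algorithm is linear probing: with \<open>m\<close> cells, item \<open>t\<close> is sent to cell
  \<open>\<lfloor>m t\<rfloor>\<close> and written into the first empty cell from there on, or, if there is none, into the
  first empty cell of the array (the item is then \<^emph>\<open>wrapped\<close>). The cost is at most a constant, plus
  twice the number of wrapped items, plus \<open>2 / m\<close> times the total displacement of the other items.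
  The total displacement counts, over all cells \<open>b\<close>, the items carried across the left border of
  \<open>b\<close>. These numbers, and the number of wrapped items, are controlled by the queue
  \<open>Q(b + 1) = max 0 (Q(b) + X(b) - 1)\<close>, where \<open>X(b)\<close> is the number of items hashed to \<open>b\<close>.

  Let \<open>\<alpha> = n / m\<close>. Expanding the square in the recursion gives
  \<open>E Q(b+1)\<^sup>2 \<le> E Q(b)\<^sup>2 - 2 (1 - \<alpha>) E Q(b) + 1\<close>, because moving an item to \<open>b\<close> can only decrease
  \<open>Q(b)\<close>, so that \<open>E (X(b) Q(b)) \<le> \<alpha> E Q(b)\<close>. A cyclic shift of the hash values shows that
  \<open>E Q(b)\<^sup>2\<close> increases with \<open>b\<close>; hence \<open>E Q(b) \<le> 1 / (2 (1 - \<alpha>))\<close>, and the expected cost is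
  \<open>O(1 / (1 - \<alpha>))\<close>. The optimum is at least \<open>1/3\<close> unless all items avoid the first or all avoid
  the last third of the unit interval, which has exponentially small probability, whereas the cost
  never exceeds \<open>n\<close> times the optimum.\<close>

section \<open>Placement costs\<close>

lemma finite_adjacent_items [simp]: "finite (adjacent_items n p)"
  by (rule finite_subset[of _ "{..<n} \<times> {..<n}"]) (auto simp: adjacent_items_def)

lemma inj_on_fst_adjacent_items:
  assumes "inj_on p {..<n}"
  shows "inj_on fst (adjacent_items n p)"
proof (rule inj_onI, clarsimp)
  fix i j j'
  assume "(i, j) \<in> adjacent_items n p" "(i, j') \<in> adjacent_items n p"
  then have "j < n" "j' < n" "\<not> p j < p j'" "\<not> p j' < p j"
    unfolding adjacent_items_def by auto
  with assms show "j = j'" by (auto simp: not_less intro: inj_onD)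
qed

lemma inj_on_snd_adjacent_items:
  assumes "inj_on p {..<n}"
  shows "inj_on snd (adjacent_items n p)"
proof (rule inj_onI, clarsimp)
  fix i i' j
  assume "(i, j) \<in> adjacent_items n p" "(i', j) \<in> adjacent_items n p"
  then have "i < n" "i' < n" "\<not> p i < p i'" "\<not> p i' < p i"
    unfolding adjacent_items_def by auto
  with assms show "i = i'" by (auto simp: not_less intro: inj_onD)
qed

text \<open>An item has at most one right neighbour, so a charge made to the left member of each
  adjacent pair is paid at most once per item. The next lemma is the mirror image for right
  members.\<close>

lemma sum_fst_adjacent_items_le:
  fixes f :: "nat \<Rightarrow> real"
  assumes "inj_on p {..<n}" and "\<And>i. f i \<ge> 0"
  shows "(\<Sum>a\<in>adjacent_items n p. f (fst a)) \<le> (\<Sum>i<n. f i)"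
proof -
  have "(\<Sum>a\<in>adjacent_items n p. f (fst a)) = sum f (fst ` adjacent_items n p)"
    by (simp add: sum.reindex[OF inj_on_fst_adjacent_items[OF assms(1)]])
  also have "\<dots> \<le> (\<Sum>i<n. f i)"
    by (rule sum_mono2) (auto simp: adjacent_items_def assms(2))
  finally show ?thesis .
qed

lemma sum_snd_adjacent_items_le:
  fixes f :: "nat \<Rightarrow> real"
  assumes "inj_on p {..<n}" and "\<And>i. f i \<ge> 0"
  shows "(\<Sum>a\<in>adjacent_items n p. f (snd a)) \<le> (\<Sum>i<n. f i)"
proof -
  have "(\<Sum>a\<in>adjacent_items n p. f (snd a)) = sum f (snd ` adjacent_items n p)"
    by (simp add: sum.reindex[OF inj_on_snd_adjacent_items[OF assms(1)]])
  also have "\<dots> \<le> (\<Sum>i<n. f i)"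
    by (rule sum_mono2) (auto simp: adjacent_items_def assms(2))
  finally show ?thesis .
qed

lemma card_adjacent_items_le:
  assumes "inj_on p {..<n}"
  shows "card (adjacent_items n p) \<le> n"
  using sum_fst_adjacent_items_le[OF assms, of "\<lambda>_. 1"] by simp

text \<open>No item lies strictly between two neighbours, so the half-open cell intervals spanned by
  different adjacent pairs are disjoint subsets of the array.\<close>

lemma sum_gaps_adjacent_items_le:
  assumes "inj_on p {..<n}" and "p ` {..<n} \<subseteq> {..<m}"
  shows "(\<Sum>(i, j)\<in>adjacent_items n p. p j - p i) \<le> m"
proof -
  have "(\<Sum>(i, j)\<in>adjacent_items n p. p j - p i)
      = (\<Sum>a\<in>adjacent_items n p. card {p (fst a)..<p (snd a)})"
    by (simp add: case_prod_beta)
  also have "\<dots> = card (\<Union>a\<in>adjacent_items n p. {p (fst a)..<p (snd a)})"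
  proof (rule card_UN_disjoint[symmetric])
    show "\<forall>a\<in>adjacent_items n p. \<forall>a'\<in>adjacent_items n p. a \<noteq> a' \<longrightarrow>
        {p (fst a)..<p (snd a)} \<inter> {p (fst a')..<p (snd a')} = {}"
    proof (intro ballI impI)
      fix a a' assume a: "a \<in> adjacent_items n p" "a' \<in> adjacent_items n p" "a \<noteq> a'"
      obtain i j i' j' where [simp]: "a = (i, j)" "a' = (i', j')" by (metis surj_pair)
      have "i \<noteq> i'"
        using inj_onD[OF inj_on_fst_adjacent_items[OF assms(1)] _ a(1,2)] a(3) by auto
      then have "p i \<noteq> p i'"
        using inj_onD[OF assms(1), of i i'] a(1,2) by (auto simp: adjacent_items_def)
      moreover have "\<not> (p i < p i' \<and> p i' < p j)" "\<not> (p i' < p i \<and> p i < p j')"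
        using a(1,2) by (auto simp: adjacent_items_def)
      ultimately show "{p (fst a)..<p (snd a)} \<inter> {p (fst a')..<p (snd a')} = {}"
        by auto
    qed
  qed auto
  also have "\<dots> \<le> card {..<m}"
  proof (rule card_mono)
    have "p j \<le> m" if "j < n" for j
      using assms(2) that by (auto intro: less_imp_le)
    then show "(\<Union>a\<in>adjacent_items n p. {p (fst a)..<p (snd a)}) \<subseteq> {..<m}"
      by (force simp: adjacent_items_def)
  qed simp
  finally show ?thesis by simp
qed

section \<open>Placement cost against the spread of the items\<close>

lemma placement_cost_nonneg: "placement_cost n p x \<ge> 0"
  unfolding placement_cost_def by (rule sum_nonneg) auto

text \<open>Triangle inequality along the chain of neighbours leading from \<open>i\<close> to
  \<open>j\<close>. Restricting the sum to pairs that end no later than \<open>p j\<close> makes the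
  induction on \<open>p j\<close> go through.\<close>

lemma abs_diff_le_placement_cost_aux:
  fixes x :: "nat \<Rightarrow> real"
  assumes p: "inj_on p {..<n}" and "i < n"
  shows "j < n \<Longrightarrow> p i \<le> p j \<Longrightarrow>
    \<bar>x i - x j\<bar> \<le> (\<Sum>(u, v)\<in>{(u, v)\<in>adjacent_items n p. p v \<le> p j}. \<bar>x u - x v\<bar>)"
proof (induction "p j" arbitrary: j rule: less_induct)
  case less
  show ?case
  proof (cases "p i = p j")
    case True
    then have "i = j" using p \<open>i < n\<close> less.prems by (auto dest: inj_onD)
    then show ?thesis by (auto intro!: sum_nonneg)
  next
    case False
    \<comment> \<open>The rightmost item before \<open>j\<close> is its left neighbour; the chain is
      shortened to it.\<close>
    define K where "K = {k. k < n \<and> p k < p j}"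
    have "finite K" "i \<in> K" using False less.prems \<open>i < n\<close> by (auto simp: K_def)
    have "Max (p ` K) \<in> p ` K" using \<open>finite K\<close> \<open>i \<in> K\<close> by (intro Max_in) auto
    then obtain k where "k \<in> K" and Max: "Max (p ` K) = p k" by auto
    moreover have "p l \<le> p k" if "l \<in> K" for l
      using Max_ge[of "p ` K" "p l"] that \<open>finite K\<close> Max by simp
    ultimately have k: "k \<in> K" "\<And>l. l \<in> K \<Longrightarrow> p l \<le> p k" by blast+
    then have kj: "k < n" "p k < p j" "p i \<le> p k" using \<open>i \<in> K\<close> by (auto simp: K_def)
    have adj: "(k, j) \<in> adjacent_items n p"
      using k less.prems by (force simp: adjacent_items_def K_def)
    have "\<bar>x i - x j\<bar> \<le> \<bar>x k - x j\<bar> + \<bar>x i - x k\<bar>" by simp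
    also have "\<dots> \<le> \<bar>x k - x j\<bar> +
        (\<Sum>(u, v)\<in>{(u, v)\<in>adjacent_items n p. p v \<le> p k}. \<bar>x u - x v\<bar>)"
      using less.hyps[of k] kj by simp
    also have "\<dots> = (\<Sum>(u, v)\<in>insert (k, j) {(u, v)\<in>adjacent_items n p. p v \<le> p k}. \<bar>x u - x v\<bar>)"
      using kj by (subst sum.insert) (auto intro: finite_subset[OF _ finite_adjacent_items])
    also have "\<dots> \<le> (\<Sum>(u, v)\<in>{(u, v)\<in>adjacent_items n p. p v \<le> p j}. \<bar>x u - x v\<bar>)"
      using adj kj by (intro sum_mono2) (auto intro: finite_subset[OF _ finite_adjacent_items])
    finally show ?thesis .
  qed
qed

lemma abs_diff_le_placement_cost:
  assumes "inj_on p {..<n}" and "i < n" and "j < n"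
  shows "\<bar>x i - x j\<bar> \<le> placement_cost n p x"
proof -
  have le: "\<bar>x i - x j\<bar> \<le> placement_cost n p x" if "i < n" "j < n" "p i \<le> p j" for i j
  proof -
    have "\<bar>x i - x j\<bar> \<le> (\<Sum>(u, v)\<in>{(u, v)\<in>adjacent_items n p. p v \<le> p j}. \<bar>x u - x v\<bar>)"
      using abs_diff_le_placement_cost_aux[OF assms(1)] that by blast
    also have "\<dots> \<le> placement_cost n p x"
      unfolding placement_cost_def by (rule sum_mono2) auto
    finally show ?thesis .
  qed
  show ?thesis
    using le[of i j] le[of j i] assms(2,3) by (cases "p i \<le> p j") (auto simp: abs_minus_commute)
qed

lemma finite_placements: "finite (placements n m)"
  unfolding placements_def by (rule finite_subset[of _ "{..<n} \<rightarrow>\<^sub>E {..<m}"]) (auto intro: finite_PiE)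

lemma offline_opt_le: "p \<in> placements n m \<Longrightarrow> offline_opt n m x \<le> placement_cost n p x"
  unfolding offline_opt_def by (intro Min_le) (auto simp: finite_placements)

text \<open>The bound holds for each placement separately, hence for the minimum. Existence of a
  placement matters because \<open>Min\<close> of the empty set is unspecified.\<close>

lemma abs_diff_le_offline_opt:
  assumes "placements n m \<noteq> {}" and "i < n" and "j < n"
  shows "\<bar>x i - x j\<bar> \<le> offline_opt n m x"
proof -
  have "\<bar>x i - x j\<bar> \<le> placement_cost n p x" if "p \<in> placements n m" for p
    using that assms(2,3) by (intro abs_diff_le_placement_cost) (auto simp: placements_def)
  then show ?thesis
    unfolding offline_opt_def using assms(1) by (subst Min_ge_iff) (auto simp: finite_placements)
qed

lemma offline_opt_nonneg: "placements n m \<noteq> {} \<Longrightarrow> offline_opt n m x \<ge> 0"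
  unfolding offline_opt_def
  by (subst Min_ge_iff) (auto simp: finite_placements placement_cost_nonneg)

text \<open>There are at most \<open>n\<close> adjacent pairs. With \<open>d\<close> taken as the
  optimum, this makes every placement \<open>n\<close>-competitive.\<close>

lemma placement_cost_le_mult:
  assumes "inj_on p {..<n}" and "\<And>i j. i < n \<Longrightarrow> j < n \<Longrightarrow> \<bar>x i - x j\<bar> \<le> d" and "d \<ge> 0"
  shows "placement_cost n p x \<le> real n * d"
proof -
  have "placement_cost n p x \<le> (\<Sum>a\<in>adjacent_items n p. d)"
    unfolding placement_cost_def by (rule sum_mono) (auto simp: adjacent_items_def intro: assms(2))
  also have "\<dots> \<le> real n * d"
    using card_adjacent_items_le[OF assms(1)] assms(3) by (simp add: mult_right_mono)
  finally show ?thesis .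
qed

section \<open>Linear probing\<close>

text \<open>Neither \<open>LEAST\<close> is bounded by \<open>m\<close>: if the array is full, the
  result is a cell beyond its end. A probe therefore always avoids a finite \<open>S\<close>, and
  distinctness of slots needs no bound on the number of items.\<close>

definition probe :: "nat \<Rightarrow> nat set \<Rightarrow> nat \<Rightarrow> nat" where
  "probe m S c = (if {c..<m} \<subseteq> S then LEAST d. d \<notin> S else LEAST d. c \<le> d \<and> d \<notin> S)"

lemma probe_notin:
  assumes "finite S"
  shows "probe m S c \<notin> S"
proof (cases "{c..<m} \<subseteq> S")
  case True
  have "\<exists>d. d \<notin> S" using assms ex_new_if_finite infinite_UNIV_nat by blast
  then have "(LEAST d. d \<notin> S) \<notin> S" by (rule LeastI_ex)
  with True show ?thesis by (simp add: probe_def)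
next
  case False
  then have "\<exists>d. c \<le> d \<and> d \<notin> S" by auto
  from LeastI_ex[OF this] False show ?thesis by (simp add: probe_def)
qed

lemma probe_less:
  assumes "finite S" and "card S < m"
  shows "probe m S c < m"
proof (cases "{c..<m} \<subseteq> S")
  case True
  have "\<not> {..<m} \<subseteq> S" using card_mono[OF assms(1), of "{..<m}"] assms(2) by auto
  then obtain d where "d < m" "d \<notin> S" by auto
  then have "(LEAST d. d \<notin> S) < m" by (meson Least_le le_less_trans)
  with True show ?thesis by (simp add: probe_def)
next
  case False
  then obtain d where "d < m" "c \<le> d" "d \<notin> S" by (meson atLeastLessThan_iff subsetI)
  then have "(LEAST d. c \<le> d \<and> d \<notin> S) < m" by (metis (mono_tags, lifting) Least_le le_less_trans)
  with False show ?thesis by (auto simp: probe_def)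
qed

lemma probe_direct: "c \<le> probe m S c \<Longrightarrow> {c..<probe m S c} \<subseteq> S"
  by (auto simp: probe_def split: if_splits dest: not_less_Least)

lemma probe_wrapped:
  assumes "probe m S c < c"
  shows "{c..<m} \<subseteq> S" and "{..<probe m S c} \<subseteq> S"
proof -
  show full: "{c..<m} \<subseteq> S"
  proof (rule ccontr)
    assume nfull: "\<not> {c..<m} \<subseteq> S"
    then have "\<exists>d. c \<le> d \<and> d \<notin> S" by auto
    from LeastI_ex[OF this] nfull assms show False by (simp add: probe_def)
  qed
  then show "{..<probe m S c} \<subseteq> S"
    by (auto simp: probe_def dest: not_less_Least)
qed

section \<open>Successive insertions\<close>

primrec occupied :: "nat \<Rightarrow> (nat \<Rightarrow> nat) \<Rightarrow> nat \<Rightarrow> nat set" where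
  "occupied m h 0 = {}"
| "occupied m h (Suc j) = insert (probe m (occupied m h j) (h j)) (occupied m h j)"

definition slot :: "nat \<Rightarrow> (nat \<Rightarrow> nat) \<Rightarrow> nat \<Rightarrow> nat" where
  "slot m h j = probe m (occupied m h j) (h j)"

lemma occupied_eq_image: "occupied m h j = slot m h ` {..<j}"
  by (induction j) (auto simp: slot_def lessThan_Suc)

lemma occupied_cong: "(\<And>i. i < j \<Longrightarrow> h i = h' i) \<Longrightarrow> occupied m h j = occupied m h' j"
  by (induction j) auto

text \<open>This is what makes the procedure online: a slot depends only on the hash values revealed
  so far.\<close>

lemma slot_cong: "(\<And>i. i \<le> j \<Longrightarrow> h i = h' i) \<Longrightarrow> slot m h j = slot m h' j"
  unfolding slot_def by (simp add: occupied_cong[of j h h'])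

lemma inj_slot: "inj (slot m h)"
proof -
  have "slot m h i \<noteq> slot m h j" if "i < j" for i j
    using that probe_notin[of "occupied m h j" m "h j"]
    by (metis finite_imageI finite_lessThan imageI lessThan_iff occupied_eq_image slot_def)
  then show ?thesis by (metis injI linorder_neqE_nat)
qed

lemma slot_less:
  assumes "j < m"
  shows "slot m h j < m"
  unfolding slot_def using assms
  by (intro probe_less) (auto simp: occupied_eq_image card_image inj_on_subset[OF inj_slot])

section \<open>Crossings and queues\<close>

definition load :: "nat \<Rightarrow> (nat \<Rightarrow> nat) \<Rightarrow> nat \<Rightarrow> nat" where
  "load n h b = card {i. i < n \<and> h i = b}"

text \<open>Lindley's recursion with one item served per cell; truncated subtraction is the maximum with \<open>0\<close>.\<close>

primrec queue :: "nat \<Rightarrow> (nat \<Rightarrow> nat) \<Rightarrow> nat \<Rightarrow> nat" where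
  "queue n h 0 = 0"
| "queue n h (Suc b) = queue n h b + load n h b - 1"

text \<open>Each step of the recursion satisfies \<open>Q(b + 1) \<ge> Q(b) + X(b) - 1\<close>;
  summing from \<open>k\<close> to \<open>b\<close> and dropping \<open>Q(k) \<ge> 0\<close> gives
  the bound. It will be used with \<open>k\<close> just after an empty cell, or with
  \<open>k = 0\<close>.\<close>

lemma card_le_queue:
  assumes "k \<le> b"
  shows "card {i. i < n \<and> k \<le> h i \<and> h i < b} \<le> queue n h b + (b - k)"
  using assms
proof (induction b rule: dec_induct)
  case base
  have empty: "{i. i < n \<and> k \<le> h i \<and> h i < k} = {}" by auto
  show ?case unfolding empty by simp
next
  case (step b)
  have "{i. i < n \<and> k \<le> h i \<and> h i < Suc b}
      = {i. i < n \<and> k \<le> h i \<and> h i < b} \<union> {i. i < n \<and> h i = b}"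
    using step.hyps by auto
  then have "card {i. i < n \<and> k \<le> h i \<and> h i < Suc b}
      \<le> card {i. i < n \<and> k \<le> h i \<and> h i < b} + load n h b"
    by (simp add: load_def card_Un_le)
  with step show ?case by simp
qed

text \<open>All that the cost analysis uses of linear probing: properties of the final table, with
  the order of arrival forgotten. The strict inequality between items and cells leaves some cell
  empty.\<close>

locale probing =
  fixes n m :: nat and h p :: "nat \<Rightarrow> nat"
  assumes n_less_m: "n < m"
    and inj: "inj_on p {..<n}"
    and less_m: "i < n \<Longrightarrow> p i < m"
    and hash_less_m: "i < n \<Longrightarrow> h i < m"
    and direct: "i < n \<Longrightarrow> h i \<le> p i \<Longrightarrow> {h i..<p i} \<subseteq> p ` {..<n}"
    and wrapped_above: "i < n \<Longrightarrow> p i < h i \<Longrightarrow> {h i..<m} \<subseteq> p ` {..<n}"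
    and wrapped_below: "i < n \<Longrightarrow> p i < h i \<Longrightarrow> {..<p i} \<subseteq> p ` {..<n}"
begin

definition wrapped :: "nat set" where
  "wrapped = {i. i < n \<and> p i < h i}"

definition crossing :: "nat \<Rightarrow> nat set" where
  "crossing b = {i. i < n \<and> h i < b \<and> b \<le> p i}"

lemma finite_wrapped [simp]: "finite wrapped"
  by (auto simp: wrapped_def)

lemma finite_crossing [simp]: "finite (crossing b)"
  by (auto simp: crossing_def)

lemma card_items_in_full_range:
  assumes "{k..<b} \<subseteq> p ` {..<n}"
  shows "card {i. i < n \<and> k \<le> p i \<and> p i < b} = b - k"
proof -
  have "p ` {i. i < n \<and> k \<le> p i \<and> p i < b} = {k..<b}"
    using assms by auto
  moreover have "inj_on p {i. i < n \<and> k \<le> p i \<and> p i < b}"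
    by (rule inj_on_subset[OF inj]) auto
  ultimately show ?thesis by (metis card_atLeastLessThan card_image)
qed

lemma last_empty_cell:
  assumes "\<not> {..<b} \<subseteq> p ` {..<n}"
  obtains e where "e < b" "e \<notin> p ` {..<n}" "{Suc e..<b} \<subseteq> p ` {..<n}"
proof -
  let ?E = "{..<b} - p ` {..<n}"
  have "Max ?E \<in> ?E" using assms by (intro Max_in) auto
  moreover have "{Suc (Max ?E)..<b} \<subseteq> p ` {..<n}"
  proof
    fix c assume "c \<in> {Suc (Max ?E)..<b}"
    then have "\<not> c \<le> Max ?E" "c < b" by auto
    then show "c \<in> p ` {..<n}" using Max_ge[of ?E c] by auto
  qed
  ultimately show ?thesis using that by blast
qed

text \<open>No item probes past a cell that stays empty: an item travelling directly from
  \<open>h i \<le> e\<close> would have stopped at \<open>e\<close>, and a wrapped item landing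
  beyond \<open>e\<close> would have filled \<open>e\<close> first.\<close>

lemma after_empty_cell:
  assumes "e \<notin> p ` {..<n}" and "i < n" and "e < p i"
  shows "e < h i" and "i \<notin> wrapped"
proof -
  show "i \<notin> wrapped" using wrapped_below[of i] assms by (auto simp: wrapped_def)
  with assms direct[of i] show "e < h i" by (force simp: wrapped_def not_less)
qed

text \<open>Let \<open>e\<close> be the last empty cell. The items stored beyond \<open>e\<close>
  and the wrapped items all hash beyond \<open>e\<close>; the former exactly fill the
  \<open>m - Suc e\<close> cells there, so the latter are surplus counted by the queue at the end of
  the array.\<close>

lemma card_wrapped_le: "card wrapped \<le> queue n h m"
proof -
  have "\<not> {..<m} \<subseteq> p ` {..<n}"
    using n_less_m surj_card_le[of "{..<n}" "{..<m}" p] by auto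
  then obtain e where e: "e < m" "e \<notin> p ` {..<n}" "{Suc e..<m} \<subseteq> p ` {..<n}"
    by (rule last_empty_cell)
  define J where "J = {i. i < n \<and> Suc e \<le> p i \<and> p i < m}"
  have sub: "J \<union> wrapped \<subseteq> {i. i < n \<and> Suc e \<le> h i \<and> h i < m}"
  proof -
    have "e < h i" if "i \<in> wrapped" for i
    proof (rule ccontr)
      assume "\<not> e < h i"
      then have "e \<in> {h i..<m}" using e(1) by simp
      with that wrapped_above[of i] e(2) show False by (auto simp: wrapped_def)
    qed
    moreover have "e < h i" if "i \<in> J" for i
      using after_empty_cell(1)[OF e(2), of i] that by (simp add: J_def)
    ultimately show ?thesis
      using hash_less_m by (auto simp: J_def Suc_le_eq wrapped_def)
  qed
  have "(m - Suc e) + card wrapped = card J + card wrapped"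
    using card_items_in_full_range[OF e(3)] by (simp add: J_def)
  also have "\<dots> = card (J \<union> wrapped)"
  proof (rule card_Un_disjoint[symmetric])
    show "J \<inter> wrapped = {}"
      using after_empty_cell(2)[OF e(2)] by (auto simp: J_def Suc_le_eq)
  qed (auto simp: J_def)
  also have "\<dots> \<le> card {i. i < n \<and> Suc e \<le> h i \<and> h i < m}"
    by (rule card_mono[OF _ sub]) auto
  also have "\<dots> \<le> queue n h m + (m - Suc e)"
    using e by (intro card_le_queue) auto
  finally show ?thesis by simp
qed

text \<open>The same surplus count, started after the last empty cell before \<open>b\<close>. If
  there is no such cell, the count starts at cell 0, and wrapped items may occupy cells below
  \<open>b\<close> without hashing there; this costs the extra term.\<close>

lemma card_crossing_le: "card (crossing b) \<le> queue n h b + card wrapped"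
proof (cases "{..<b} \<subseteq> p ` {..<n}")
  case True
  define J where "J = {i. i < n \<and> 0 \<le> p i \<and> p i < b}"
  have "b + card (crossing b) = card J + card (crossing b)"
    using card_items_in_full_range[of 0 b] True by (simp add: J_def atLeast0LessThan)
  also have "\<dots> = card (J \<union> crossing b)"
    by (intro card_Un_disjoint[symmetric]) (auto simp: J_def crossing_def)
  also have "\<dots> \<le> card ({i. i < n \<and> 0 \<le> h i \<and> h i < b} \<union> wrapped)"
    by (intro card_mono) (auto simp: J_def crossing_def wrapped_def)
  also have "\<dots> \<le> card {i. i < n \<and> 0 \<le> h i \<and> h i < b} + card wrapped"
    by (rule card_Un_le)
  also have "\<dots> \<le> queue n h b + b + card wrapped"
    using card_le_queue[of 0 b n h] by simp
  finally show ?thesis by simp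
next
  case False
  then obtain e where e: "e < b" "e \<notin> p ` {..<n}" "{Suc e..<b} \<subseteq> p ` {..<n}"
    by (rule last_empty_cell)
  define J where "J = {i. i < n \<and> Suc e \<le> p i \<and> p i < b}"
  have "(b - Suc e) + card (crossing b) = card J + card (crossing b)"
    using card_items_in_full_range[OF e(3)] by (simp add: J_def)
  also have "\<dots> = card (J \<union> crossing b)"
    by (intro card_Un_disjoint[symmetric]) (auto simp: J_def crossing_def)
  also have "\<dots> \<le> card {i. i < n \<and> Suc e \<le> h i \<and> h i < b}"
  proof (rule card_mono)
    have "e < h i" "h i \<le> p i" if "i < n" "e < p i" for i
      using after_empty_cell[OF e(2) that] that(1) by (auto simp: wrapped_def not_less)
    then show "J \<union> crossing b \<subseteq> {i. i < n \<and> Suc e \<le> h i \<and> h i < b}"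
      using e(1) by (fastforce simp: J_def crossing_def Suc_le_eq)
  qed simp
  also have "\<dots> \<le> queue n h b + (b - Suc e)"
    using e by (intro card_le_queue) auto
  finally show ?thesis by simp
qed

text \<open>Double counting of pairs of an item and a cell border it crosses. Truncated subtraction
  gives 0 for wrapped items, which cross no border.\<close>

lemma sum_displacement: "(\<Sum>i<n. p i - h i) = (\<Sum>b<m. card (crossing b))"
proof -
  have "(\<Sum>i<n. p i - h i) = (\<Sum>i<n. card {b\<in>{..<m}. h i < b \<and> b \<le> p i})"
  proof (rule sum.cong)
    fix i assume "i \<in> {..<n}"
    then have "{b\<in>{..<m}. h i < b \<and> b \<le> p i} = {h i<..p i}" using less_m[of i] by auto
    then show "p i - h i = card {b\<in>{..<m}. h i < b \<and> b \<le> p i}" by simp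
  qed simp
  also have "\<dots> = (\<Sum>b<m. card {i\<in>{..<n}. h i < b \<and> b \<le> p i})"
    by (rule sum_multicount_gen[symmetric]) auto
  finally show ?thesis by (simp add: crossing_def)
qed

text \<open>After scaling by \<open>m\<close>, values differ by at most the distance of the cells
  plus both displacements plus a rounding error of 1. Cell distances and rounding errors add up to
  at most \<open>2 * m\<close>. Each item is charged on both sides, and wrapped items enter both
  directly and through the crossing bound of all \<open>m\<close> cells, whence the factor
  4.\<close>

lemma placement_cost_le:
  assumes unit: "\<And>i. i < n \<Longrightarrow> 0 \<le> x i \<and> x i \<le> 1"
    and hash: "\<And>i. i < n \<Longrightarrow> real (h i) \<le> real m * x i \<and> real m * x i \<le> real (h i) + 1"
  shows "placement_cost n p x
    \<le> 2 + 4 * real (queue n h m) + 2 / real m * (\<Sum>b<m. real (queue n h b))"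
proof -
  let ?adj = "adjacent_items n p"
  \<comment> \<open>The charge of an item: its displacement, or the full scaled length
    \<open>m\<close> of the unit interval if it is wrapped.\<close>
  define f where "f i = real (p i - h i) + (if i \<in> wrapped then real m else 0)" for i
  have f_nonneg: "f i \<ge> 0" for i by (simp add: f_def)
  have m: "real m > 0" using n_less_m by simp
  have pair: "real m * \<bar>x i - x j\<bar> \<le> real (p j - p i) + f i + f j + 1" if "(i, j) \<in> ?adj" for i j
  proof -
    from that have ij: "i < n" "j < n" "p i < p j" by (auto simp: adjacent_items_def)
    show ?thesis
    proof (cases "i \<in> wrapped \<or> j \<in> wrapped")
      case True
      have "\<bar>x i - x j\<bar> \<le> 1" using unit[OF ij(1)] unit[OF ij(2)] by auto
      then have "real m * \<bar>x i - x j\<bar> \<le> real m" using m by (simp add: mult_left_le)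
      also have "\<dots> \<le> f i + f j" using True by (auto simp: f_def)
      finally show ?thesis by simp
    next
      case False
      then have le: "h i \<le> p i" "h j \<le> p j" using ij by (auto simp: wrapped_def)
      have "real m * \<bar>x i - x j\<bar> = \<bar>real m * x i - real m * x j\<bar>"
        using m by (simp add: abs_mult right_diff_distrib[symmetric])
      \<comment> \<open>Both hash values are rounded down, so the two rounding errors lie in
        \<open>[0, 1]\<close> and differ by at most 1.\<close>
      also have "\<dots> \<le> \<bar>real (h i) - real (h j)\<bar> + 1"
        using hash[OF ij(1)] hash[OF ij(2)] by linarith
      also have "\<dots> \<le> real (p j - p i) + f i + f j + 1"
        using le ij False by (auto simp: f_def of_nat_diff)
      finally show ?thesis .
    qed
  qed
  have "real m * placement_cost n p x = (\<Sum>(i, j)\<in>?adj. real m * \<bar>x i - x j\<bar>)"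
    unfolding placement_cost_def by (simp add: sum_distrib_left case_prod_beta)
  also have "\<dots> \<le> (\<Sum>(i, j)\<in>?adj. real (p j - p i) + f i + f j + 1)"
    by (rule sum_mono) (auto intro: pair)
  also have "\<dots> = real (\<Sum>(i, j)\<in>?adj. p j - p i)
      + (\<Sum>a\<in>?adj. f (fst a)) + (\<Sum>a\<in>?adj. f (snd a)) + real (card ?adj)"
    by (simp add: sum.distrib case_prod_beta)
  also have "\<dots> \<le> real m + (\<Sum>i<n. f i) + (\<Sum>i<n. f i) + real m"
  proof (intro add_mono)
    show "real (\<Sum>(i, j)\<in>?adj. p j - p i) \<le> real m"
      using sum_gaps_adjacent_items_le[OF inj, of m] less_m by (auto simp del: of_nat_sum)
    show "real (card ?adj) \<le> real m"
      using card_adjacent_items_le[OF inj] n_less_m by simp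
  qed (rule sum_fst_adjacent_items_le sum_snd_adjacent_items_le, rule inj, rule f_nonneg)+
  also have "(\<Sum>i<n. f i) = real (\<Sum>i<n. p i - h i) + real m * real (card wrapped)"
  proof -
    have "{..<n} \<inter> wrapped = wrapped" by (auto simp: wrapped_def)
    then show ?thesis
      by (simp add: f_def sum.distrib sum.If_cases)
  qed
  also have "(\<Sum>i<n. p i - h i) \<le> (\<Sum>b<m. queue n h b + card wrapped)"
    unfolding sum_displacement by (rule sum_mono) (rule card_crossing_le)
  finally have "real m * placement_cost n p x \<le> 2 * real m +
      2 * (real (\<Sum>b<m. queue n h b + card wrapped) + real m * real (card wrapped))"
    by simp
  also have "real (\<Sum>b<m. queue n h b + card wrapped)
      = (\<Sum>b<m. real (queue n h b)) + real m * real (card wrapped)"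
    by (simp add: sum.distrib)
  also have "real m * real (card wrapped) \<le> real m * real (queue n h m)"
    using card_wrapped_le by (simp add: mult_left_mono)
  finally have "real m * placement_cost n p x
      \<le> real m * (2 + 4 * real (queue n h m) + 2 / real m * (\<Sum>b<m. real (queue n h b)))"
    using m by (simp add: algebra_simps)
  then show ?thesis using m by simp
qed

end

lemma probing_slot:
  assumes "n < m" and "\<And>i. i < n \<Longrightarrow> h i < m"
  shows "probing n m h (slot m h)"
proof
  show "inj_on (slot m h) {..<n}" by (rule inj_on_subset[OF inj_slot]) simp
  fix i assume "i < n"
  then show "slot m h i < m" using assms(1) by (intro slot_less) simp
  show "h i < m" using assms(2) \<open>i < n\<close> .
  \<comment> \<open>A cell found full on arrival stays full, so what a probe saw remains true of the
    final table.\<close>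
  have sub: "occupied m h i \<subseteq> slot m h ` {..<n}"
    using \<open>i < n\<close> by (auto simp: occupied_eq_image)
  show "{h i..<slot m h i} \<subseteq> slot m h ` {..<n}" if "h i \<le> slot m h i"
    using probe_direct[of "h i" m "occupied m h i"] that sub unfolding slot_def by blast
  assume "slot m h i < h i"
  from probe_wrapped[OF this[unfolded slot_def]] sub
  show "{h i..<m} \<subseteq> slot m h ` {..<n}" "{..<slot m h i} \<subseteq> slot m h ` {..<n}"
    unfolding slot_def by blast+
qed (rule assms(1))

section \<open>Expected queue length\<close>

text \<open>Expectations are expressed as sums over all hash functions. Overwriting coordinate
  \<open>i\<close> by \<open>b\<close> is \<open>m\<close>-to-one onto the functions with
  \<open>g i = b\<close>; the pair in the bijection remembers the erased value.\<close>

lemma sum_PiE_fun_upd: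
  fixes F :: "(nat \<Rightarrow> nat) \<Rightarrow> real"
  assumes "i < n" and "b < m"
  shows "(\<Sum>g\<in>{..<n} \<rightarrow>\<^sub>E {..<m}. F (g(i := b)))
    = real m * (\<Sum>g\<in>{..<n} \<rightarrow>\<^sub>E {..<m}. of_bool (g i = b) * F g)"
proof -
  let ?G = "{..<n} \<rightarrow>\<^sub>E {..<m}"
  have fin: "finite ?G" by (intro finite_PiE) auto
  have "(\<Sum>g\<in>?G. F (g(i := b))) = (\<Sum>(c, g)\<in>{..<m} \<times> {g\<in>?G. g i = b}. F g)"
    by (rule sum.reindex_bij_witness[of _ "\<lambda>(c, g). g(i := c)" "\<lambda>g. (g i, g(i := b))"])
      (use assms in \<open>auto simp: PiE_iff extensional_def\<close>)
  also have "\<dots> = real m * (\<Sum>g\<in>{g\<in>?G. g i = b}. F g)"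
    by (simp add: sum.cartesian_product[symmetric])
  also have "(\<Sum>g\<in>{g\<in>?G. g i = b}. F g) = (\<Sum>g\<in>?G. of_bool (g i = b) * F g)"
    by (rule sum.mono_neutral_cong_left) (use fin in auto)
  finally show ?thesis .
qed

lemma load_eq_sum: "real (load n g b) = (\<Sum>i<n. of_bool (g i = b))"
proof -
  have "{i. i < n \<and> g i = b} = {..<n} \<inter> {i. g i = b}" by auto
  then show ?thesis by (simp add: load_def of_bool_def sum.If_cases)
qed

text \<open>Size biasing: the load is a sum of indicators, so weighting by it amounts to forcing
  each item in turn into cell \<open>b\<close>.\<close>

lemma sum_load_mult:
  fixes F :: "(nat \<Rightarrow> nat) \<Rightarrow> real"
  assumes "b < m"
  shows "real m * (\<Sum>g\<in>{..<n} \<rightarrow>\<^sub>E {..<m}. real (load n g b) * F g)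
    = (\<Sum>i<n. \<Sum>g\<in>{..<n} \<rightarrow>\<^sub>E {..<m}. F (g(i := b)))"
proof -
  let ?G = "{..<n} \<rightarrow>\<^sub>E {..<m}"
  have "(\<Sum>g\<in>?G. real (load n g b) * F g) = (\<Sum>g\<in>?G. \<Sum>i<n. of_bool (g i = b) * F g)"
    by (simp only: load_eq_sum sum_distrib_right)
  also have "\<dots> = (\<Sum>i<n. \<Sum>g\<in>?G. of_bool (g i = b) * F g)"
    by (rule sum.swap)
  finally have "(\<Sum>g\<in>?G. real (load n g b) * F g) = \<dots>" .
  then have "real m * (\<Sum>g\<in>?G. real (load n g b) * F g)
      = (\<Sum>i<n. real m * (\<Sum>g\<in>?G. of_bool (g i = b) * F g))"
    by (simp only: sum_distrib_left[of "real m" _ "{..<n}"])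
  also have "\<dots> = (\<Sum>i<n. \<Sum>g\<in>?G. F (g(i := b)))"
    by (intro sum.cong) (simp_all only: sum_PiE_fun_upd[OF _ assms] lessThan_iff)
  finally show ?thesis .
qed

lemma load_fun_upd_le: "load n (g(i := b)) c \<le> load n g c + of_bool (c = b)"
proof -
  have "{j. j < n \<and> (g(i := b)) j = c} \<subseteq> {j. j < n \<and> g j = c} \<union> (if c = b then {i} else {})"
    by auto
  then have "load n (g(i := b)) c \<le> card ({j. j < n \<and> g j = c} \<union> (if c = b then {i} else {}))"
    unfolding load_def by (intro card_mono) auto
  also have "\<dots> \<le> load n g c + card (if c = b then {i} else {})"
    unfolding load_def by (rule card_Un_le)
  finally show ?thesis by (auto split: if_splits)
qed

text \<open>The queue at \<open>c\<close> sees only the loads of cells below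
  \<open>c \<le> b\<close>, and none of these gains an item.\<close>

lemma queue_fun_upd_le: "c \<le> b \<Longrightarrow> queue n (g(i := b)) c \<le> queue n g c"
proof (induction c)
  case (Suc c)
  have "queue n (g(i := b)) c \<le> queue n g c"
    by (rule Suc.IH[OF Suc_leD[OF Suc.prems]])
  moreover have "load n (g(i := b)) c \<le> load n g c"
    using load_fun_upd_le[of n g i b c] Suc.prems by simp
  ultimately show ?case unfolding queue.simps(2) by linarith
qed simp

lemma queue_Suc_le: "queue n g (Suc b) \<le> queue n g b + load n g b"
  by simp

section \<open>Moments of loads and queues over all hash functions\<close>

context
  fixes n m :: nat
  assumes n_less_m: "n < m"
begin

private abbreviation "G \<equiv> {..<n} \<rightarrow>\<^sub>E {..<m}"

lemma sum_load:
  assumes "b < m"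
  shows "(\<Sum>g\<in>G. real (load n g b)) = real n / real m * real (card G)"
  using sum_load_mult[OF assms, of n "\<lambda>_. 1"] n_less_m by (simp add: field_simps)

text \<open>Size biasing applied to the load itself, which grows by at most 1 when an item is forced
  into \<open>b\<close>.\<close>

lemma sum_load_square_le:
  assumes "b < m"
  shows "(\<Sum>g\<in>G. (real (load n g b))\<^sup>2) \<le> real n / real m * (real n / real m + 1) * real (card G)"
proof -
  have "real m * (\<Sum>g\<in>G. real (load n g b) * real (load n g b))
      = (\<Sum>i<n. \<Sum>g\<in>G. real (load n (g(i := b)) b))"
    by (rule sum_load_mult[OF assms])
  also have "\<dots> \<le> (\<Sum>i<n. \<Sum>g\<in>G. real (load n g b) + 1)"
    using load_fun_upd_le[of n _ _ b b] by (intro sum_mono) (metis of_bool_eq(2) of_nat_1 of_nat_add of_nat_mono)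
  also have "\<dots> = real n * ((real n / real m + 1) * real (card G))"
    by (simp add: sum.distrib sum_load[OF assms] distrib_right)
  finally show ?thesis
    using n_less_m by (simp add: field_simps power2_eq_square)
qed

lemma sum_load_queue_le:
  assumes "b < m"
  shows "(\<Sum>g\<in>G. real (load n g b) * real (queue n g b))
    \<le> real n / real m * (\<Sum>g\<in>G. real (queue n g b))"
proof -
  have "real m * (\<Sum>g\<in>G. real (load n g b) * real (queue n g b))
      = (\<Sum>i<n. \<Sum>g\<in>G. real (queue n (g(i := b)) b))"
    by (rule sum_load_mult[OF assms])
  also have "\<dots> \<le> (\<Sum>i<n. \<Sum>g\<in>G. real (queue n g b))"
    by (intro sum_mono) (simp add: queue_fun_upd_le)
  finally show ?thesis
    using n_less_m by (simp add: field_simps)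
qed

lemma sum_queue_square_drift:
  assumes "b < m"
  shows "(\<Sum>g\<in>G. (real (queue n g (Suc b)))\<^sup>2)
    \<le> (\<Sum>g\<in>G. (real (queue n g b))\<^sup>2)
      - 2 * (1 - real n / real m) * (\<Sum>g\<in>G. real (queue n g b)) + real (card G)"
proof -
  define \<alpha> where "\<alpha> = real n / real m"
  have \<alpha>: "0 \<le> \<alpha>" "\<alpha> \<le> 1" using n_less_m by (auto simp: \<alpha>_def)
  have "(real (queue n g (Suc b)))\<^sup>2 \<le> (real (queue n g b))\<^sup>2
      + 2 * (real (load n g b) * real (queue n g b)) - 2 * real (queue n g b)
      + (real (load n g b))\<^sup>2 - 2 * real (load n g b) + 1" (is "_ \<le> ?r g") for g
  proof -
    \<comment> \<open>Truncation matters only when queue and load both vanish; then the left side is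
      0 and the right side is 1.\<close>
    have "(real (queue n g (Suc b)))\<^sup>2 \<le> (real (queue n g b) + real (load n g b) - 1)\<^sup>2"
      by (cases "queue n g b + load n g b") (auto simp: of_nat_diff)
    also have "\<dots> = ?r g" by (simp add: power2_eq_square algebra_simps)
    finally show ?thesis .
  qed
  then have "(\<Sum>g\<in>G. (real (queue n g (Suc b)))\<^sup>2) \<le> (\<Sum>g\<in>G. ?r g)"
    by (rule sum_mono)
  also have "\<dots> = (\<Sum>g\<in>G. (real (queue n g b))\<^sup>2)
      + 2 * (\<Sum>g\<in>G. real (load n g b) * real (queue n g b)) - 2 * (\<Sum>g\<in>G. real (queue n g b))
      + (\<Sum>g\<in>G. (real (load n g b))\<^sup>2) - 2 * (\<Sum>g\<in>G. real (load n g b)) + real (card G)"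
    by (simp add: sum.distrib sum_subtractf sum_distrib_left)
  also have "\<dots> \<le> (\<Sum>g\<in>G. (real (queue n g b))\<^sup>2)
      + 2 * (\<alpha> * (\<Sum>g\<in>G. real (queue n g b))) - 2 * (\<Sum>g\<in>G. real (queue n g b))
      + \<alpha> * (\<alpha> + 1) * real (card G) - 2 * (\<alpha> * real (card G)) + real (card G)"
    unfolding \<alpha>_def sum_load[OF assms]
    using sum_load_queue_le[OF assms] sum_load_square_le[OF assms] by simp
  \<comment> \<open>The load terms combine to \<open>\<alpha> * (\<alpha> + 1) - 2 * \<alpha> = -
    \<alpha> * (1 - \<alpha>)\<close>, which is nonpositive and is dropped next.\<close>
  also have "\<dots> = (\<Sum>g\<in>G. (real (queue n g b))\<^sup>2) - 2 * (1 - \<alpha>) * (\<Sum>g\<in>G. real (queue n g b))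
      + real (card G) - \<alpha> * (1 - \<alpha>) * real (card G)"
    by (simp add: algebra_simps)
  also have "\<dots> \<le> (\<Sum>g\<in>G. (real (queue n g b))\<^sup>2) - 2 * (1 - \<alpha>) * (\<Sum>g\<in>G. real (queue n g b))
      + real (card G)"
    using \<alpha> by simp
  finally show ?thesis by (simp add: \<alpha>_def)
qed

section \<open>Monotonicity of second moments and the mean queue length\<close>

definition cyclic_shift :: "(nat \<Rightarrow> nat) \<Rightarrow> nat \<Rightarrow> nat" where
  "cyclic_shift g = (\<lambda>i\<in>{..<n}. Suc (g i) mod m)"

lemma bij_betw_cyclic_shift: "bij_betw cyclic_shift G G"
proof -
  have "inj_on cyclic_shift G"
  proof (rule inj_onI)
    fix g g' assume g: "g \<in> G" "g' \<in> G" and eq: "cyclic_shift g = cyclic_shift g'"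
    show "g = g'"
    proof (rule PiE_ext[OF g])
      fix i assume i: "i \<in> {..<n}"
      have "Suc (g i) mod m = Suc (g' i) mod m"
        using fun_cong[OF eq, of i] i by (simp add: cyclic_shift_def)
      moreover have "g i < m" "g' i < m" using PiE_mem[OF g(1) i] PiE_mem[OF g(2) i] by auto
      ultimately show "g i = g' i" by (auto simp: mod_Suc split: if_splits)
    qed
  qed
  moreover have "cyclic_shift ` G \<subseteq> G"
    unfolding cyclic_shift_def using n_less_m by (intro image_subsetI) (simp add: restrict_PiE_iff)
  ultimately show ?thesis
    by (simp add: bij_betw_def endo_inj_surj finite_PiE)
qed

lemma load_cyclic_shift:
  assumes "g \<in> G" and "Suc b < m"
  shows "load n (cyclic_shift g) (Suc b) = load n g b"
proof -
  have "g i < m" if "i < n" for i using PiE_mem[OF assms(1), of i] that by simp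
  then have "{i. i < n \<and> cyclic_shift g i = Suc b} = {i. i < n \<and> g i = b}"
    using assms(2) by (auto simp: cyclic_shift_def mod_Suc split: if_splits)
  then show ?thesis by (simp add: load_def)
qed

text \<open>The shifted queue at \<open>Suc b\<close> receives the same arrivals one cell later, but
  starts from whatever cell 0 has left over instead of from 0.\<close>

lemma queue_cyclic_shift_ge:
  assumes "g \<in> G"
  shows "b < m \<Longrightarrow> queue n g b \<le> queue n (cyclic_shift g) (Suc b)"
proof (induction b)
  case (Suc b)
  then have "queue n g b \<le> queue n (cyclic_shift g) (Suc b)" by simp
  then have "queue n g b + load n g b - 1
      \<le> queue n (cyclic_shift g) (Suc b) + load n (cyclic_shift g) (Suc b) - 1"
    using load_cyclic_shift[OF assms Suc.prems] by simp
  then show ?case by (simp only: queue.simps(2))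
qed simp

lemma sum_queue_square_mono:
  assumes "b < m"
  shows "(\<Sum>g\<in>G. (real (queue n g b))\<^sup>2) \<le> (\<Sum>g\<in>G. (real (queue n g (Suc b)))\<^sup>2)"
proof -
  have "(\<Sum>g\<in>G. (real (queue n g b))\<^sup>2)
      \<le> (\<Sum>g\<in>G. (real (queue n (cyclic_shift g) (Suc b)))\<^sup>2)"
    using queue_cyclic_shift_ge assms by (intro sum_mono power_mono) (auto simp del: queue.simps)
  also have "\<dots> = (\<Sum>g\<in>G. (real (queue n g (Suc b)))\<^sup>2)"
    by (rule sum.reindex_bij_betw[OF bij_betw_cyclic_shift])
  finally show ?thesis .
qed

text \<open>By monotonicity the second moments cannot fall, so the negative drift
  \<open>2 * (1 - \<alpha>) * E Q(b)\<close> is at most the constant 1.\<close>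

lemma sum_queue_le:
  assumes "b < m"
  shows "(\<Sum>g\<in>G. real (queue n g b)) \<le> real (card G) / (2 * (1 - real n / real m))"
proof -
  have "real n / real m < 1" using n_less_m by simp
  moreover have "2 * (1 - real n / real m) * (\<Sum>g\<in>G. real (queue n g b)) \<le> real (card G)"
    using sum_queue_square_drift[OF assms] sum_queue_square_mono[OF assms] by linarith
  ultimately show ?thesis
    by (subst pos_le_divide_eq) (auto simp only: mult.commute zero_less_mult_iff diff_gt_0_iff_gt)
qed

text \<open>The previous bound stops below \<open>m\<close>; one more step adds at most the load of
  the last cell, whose mean is at most 1.\<close>

lemma sum_queue_last_le:
  "(\<Sum>g\<in>G. real (queue n g m)) \<le> real (card G) / (2 * (1 - real n / real m)) + real (card G)"
proof -
  obtain b where b: "m = Suc b" using n_less_m by (cases m) auto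
  have "(\<Sum>g\<in>G. real (queue n g m)) \<le> (\<Sum>g\<in>G. real (queue n g b) + real (load n g b))"
    unfolding b using queue_Suc_le[of n _ b]
    by (intro sum_mono) (metis of_nat_add of_nat_mono)
  also have "\<dots> \<le> real (card G) / (2 * (1 - real n / real m)) + real n / real m * real (card G)"
    using sum_queue_le[of b] sum_load[of b] b by (simp add: sum.distrib)
  also have "real n / real m * real (card G) \<le> real (card G)"
    using n_less_m by (intro mult_left_le_one_le) auto
  finally show ?thesis by simp
qed

text \<open>With \<beta> = 1 - \<alpha>, the mean is at most \<open>2 + 4 * (1 / (2 * \<beta>) + 1)
  + 2 * (1 / (2 * \<beta>)) = 6 + 3 / \<beta>\<close>.\<close>

lemma sum_cost_bound_le:
  "(\<Sum>g\<in>G. 2 + 4 * real (queue n g m) + 2 / real m * (\<Sum>b<m. real (queue n g b)))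
    \<le> (6 + 3 / (1 - real n / real m)) * real (card G)"
proof -
  define \<beta> where "\<beta> = 1 - real n / real m"
  have "\<beta> > 0" "m > 0" using n_less_m by (auto simp: \<beta>_def)
  have "(\<Sum>g\<in>G. \<Sum>b<m. real (queue n g b)) = (\<Sum>b<m. \<Sum>g\<in>G. real (queue n g b))"
    by (rule sum.swap)
  also have "\<dots> \<le> (\<Sum>b<m. real (card G) / (2 * \<beta>))"
    unfolding \<beta>_def by (intro sum_mono sum_queue_le) simp
  finally have "2 / real m * (\<Sum>g\<in>G. \<Sum>b<m. real (queue n g b))
      \<le> 2 / real m * (real m * (real (card G) / (2 * \<beta>)))"
    by (intro mult_left_mono) auto
  also have "\<dots> = real (card G) / \<beta>"
    using \<open>m > 0\<close> by simp
  finally have "2 / real m * (\<Sum>g\<in>G. \<Sum>b<m. real (queue n g b)) \<le> real (card G) / \<beta>" .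
  moreover have "(\<Sum>g\<in>G. 2 + 4 * real (queue n g m) + 2 / real m * (\<Sum>b<m. real (queue n g b)))
    = 2 * real (card G) + 4 * (\<Sum>g\<in>G. real (queue n g m))
      + 2 / real m * (\<Sum>g\<in>G. \<Sum>b<m. real (queue n g b))"
    by (simp add: sum.distrib sum_distrib_left)
  moreover have "4 * (\<Sum>g\<in>G. real (queue n g m)) \<le> 2 * real (card G) / \<beta> + 4 * real (card G)"
    using sum_queue_last_le[folded \<beta>_def] by simp
  ultimately have "(\<Sum>g\<in>G. 2 + 4 * real (queue n g m) + 2 / real m * (\<Sum>b<m. real (queue n g b)))
    \<le> 2 * real (card G) + (2 * real (card G) / \<beta> + 4 * real (card G)) + real (card G) / \<beta>"
    by linarith
  also have "\<dots> = (6 + 3 / \<beta>) * real (card G)"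
    by (simp add: field_simps)
  finally show ?thesis by (simp add: \<beta>_def)
qed

end

section \<open>Uniform items\<close>

text \<open>On \<open>[0, 1)\<close> the reduction \<open>mod m\<close> changes nothing. It keeps
  hash values in range for every real input, so that decompositions over hash functions hold
  pointwise and not just almost everywhere.\<close>

definition hash :: "nat \<Rightarrow> real \<Rightarrow> nat" where
  "hash m t = nat \<lfloor>real m * t\<rfloor> mod m"

definition linear_probing :: "nat \<Rightarrow> real list \<Rightarrow> nat" where
  "linear_probing m xs = slot m (\<lambda>i. hash m (xs ! i)) (length xs - 1)"

definition hashes :: "nat \<Rightarrow> nat \<Rightarrow> (nat \<Rightarrow> real) \<Rightarrow> nat \<Rightarrow> nat" where
  "hashes n m x = (\<lambda>i\<in>{..<n}. hash m (x i))"

section \<open>Validity of the algorithm on every input\<close>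

lemma hash_less: "m > 0 \<Longrightarrow> hash m t < m"
  by (simp add: hash_def)

lemma hash_bounds:
  assumes "0 < t" and "t < 1" and "m > 0"
  shows "real (hash m t) \<le> real m * t \<and> real m * t \<le> real (hash m t) + 1"
proof -
  have "real m * t < real m" "0 \<le> real m * t" using assms by simp_all
  then have "0 \<le> \<lfloor>real m * t\<rfloor>" "\<lfloor>real m * t\<rfloor> < int m" by (auto simp: floor_less_iff)
  then have "real (hash m t) = of_int \<lfloor>real m * t\<rfloor>" by (simp add: hash_def nat_less_iff)
  then show ?thesis by linarith
qed

lemma hashes_in_PiE: "m > 0 \<Longrightarrow> hashes n m x \<in> {..<n} \<rightarrow>\<^sub>E {..<m}"
  by (auto simp: hashes_def hash_less)

lemma online_placement_linear_probing:
  "online_placement (linear_probing m) n x = (\<lambda>j\<in>{..<n}. slot m (hashes n m x) j)"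
  unfolding online_placement_def
proof (rule restrict_ext)
  fix j assume j: "j \<in> {..<n}"
  have "hash m (map x [0..<Suc j] ! i) = hashes n m x i" if "i \<le> j" for i
    using that j by (subst nth_map) (auto simp: hashes_def simp del: upt_Suc)
  then have "slot m (\<lambda>i. hash m (map x [0..<Suc j] ! i)) j = slot m (hashes n m x) j"
    by (rule slot_cong)
  then show "linear_probing m (map x [0..<Suc j]) = slot m (hashes n m x) j"
    by (simp add: linear_probing_def)
qed

lemma online_sorting_algorithm_linear_probing:
  assumes "n \<le> m"
  shows "online_sorting_algorithm n m (linear_probing m)"
  unfolding online_sorting_algorithm_def online_placement_linear_probing placements_def
  using assms by (auto intro!: slot_less simp: inj_on_def inj_eq[OF inj_slot])

lemma placement_cost_restrict: "placement_cost n (restrict p {..<n}) x = placement_cost n p x"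
proof -
  have "adjacent_items n (restrict p {..<n}) = adjacent_items n p"
    unfolding adjacent_items_def by auto
  then show ?thesis by (simp add: placement_cost_def)
qed

lemma online_cost_linear_probing:
  "online_cost (linear_probing m) n x = placement_cost n (slot m (hashes n m x)) x"
  by (simp add: online_cost_def online_placement_linear_probing placement_cost_restrict)

text \<open>Exactly one summand survives. This turns a quantity depending on random hash values into
  a finite sum over fixed hash functions, from which measurability and integrals are read
  off.\<close>

lemma sum_over_hashes:
  assumes "m > 0"
  shows "(\<Sum>g\<in>{..<n} \<rightarrow>\<^sub>E {..<m}. of_bool (\<forall>i<n. hash m (x i) = g i) * (F g :: real)) = F (hashes n m x)"
proof -
  have "(\<Sum>g\<in>{..<n} \<rightarrow>\<^sub>E {..<m}. of_bool (\<forall>i<n. hash m (x i) = g i) * F g)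
      = (\<Sum>g\<in>{..<n} \<rightarrow>\<^sub>E {..<m}. if g = hashes n m x then F g else 0)"
  proof (rule sum.cong)
    fix g assume "g \<in> {..<n} \<rightarrow>\<^sub>E {..<m}"
    then have "(\<forall>i<n. hash m (x i) = g i) \<longleftrightarrow> g = hashes n m x"
      by (auto simp: hashes_def fun_eq_iff PiE_iff extensional_def)
    then show "of_bool (\<forall>i<n. hash m (x i) = g i) * F g = (if g = hashes n m x then F g else 0)"
      by simp
  qed simp
  also have "\<dots> = F (hashes n m x)"
    using hashes_in_PiE[OF assms] by (simp add: finite_PiE)
  finally show ?thesis .
qed

section \<open>The probability space, measurability and the law of the hash values\<close>

lemma prob_space_uniform: "prob_space (uniform_measure lborel {0<..<1::real})"
  by (rule prob_space_uniform_measure) auto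

lemma finite_product_prob_space_uniform:
  "finite_product_prob_space (\<lambda>_. uniform_measure lborel {0<..<1::real}) {..<n::nat}"
proof -
  interpret prob_space "uniform_measure lborel {0<..<1::real}" by (rule prob_space_uniform)
  show ?thesis by unfold_locales auto
qed

lemma prob_space_uniform_items: "prob_space (uniform_items n)"
  unfolding uniform_items_def by (rule prob_space_PiM) (rule prob_space_uniform)

lemma sets_uniform_items [measurable_cong]: "sets (uniform_items n) = sets (Pi\<^sub>M {..<n} (\<lambda>_. borel))"
  unfolding uniform_items_def by (rule sets_PiM_cong) auto

lemma measure_uniform_items:
  assumes "\<And>i. i < n \<Longrightarrow> S i \<in> sets borel"
  shows "measure (uniform_items n) {x\<in>space (uniform_items n). \<forall>i<n. x i \<in> S i}
    = (\<Prod>i<n. measure lborel ({0<..<1} \<inter> S i))"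
proof -
  interpret finite_product_prob_space "\<lambda>_. uniform_measure lborel {0<..<1::real}" "{..<n}"
    by (rule finite_product_prob_space_uniform)
  have eq: "{x\<in>space (uniform_items n). \<forall>i<n. x i \<in> S i} = Pi\<^sub>E {..<n} S"
    by (simp add: set_eq_iff uniform_items_def space_PiM PiE_iff Ball_def conj_commute)
  have "measure (uniform_items n) (Pi\<^sub>E {..<n} S)
      = (\<Prod>i<n. measure (uniform_measure lborel {0<..<1}) (S i))"
    unfolding uniform_items_def using assms by (intro finite_measure_PiM_emb) simp
  then show ?thesis unfolding eq using assms by simp
qed

lemma AE_uniform_items: "AE x in uniform_items n. \<forall>i<n. 0 < x i \<and> x i < 1"
proof -
  have "AE x in uniform_items n. 0 < x i \<and> x i < 1" if "i < n" for i
    unfolding uniform_items_def using that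
    by (intro AE_PiM_component prob_space_uniform AE_uniform_measureI) auto
  then have "AE x in uniform_items n. \<forall>i\<in>{..<n}. 0 < x i \<and> x i < 1"
    by (intro eventually_ball_finite) auto
  then show ?thesis by (simp only: Ball_def lessThan_iff)
qed

lemma measurable_hash [measurable]: "hash m \<in> borel \<rightarrow>\<^sub>M count_space UNIV"
  unfolding hash_def by measurable

lemma measurable_item: "i < n \<Longrightarrow> (\<lambda>x. x i) \<in> borel_measurable (uniform_items n)"
  by (subst measurable_cong_sets[OF sets_uniform_items refl]) (rule measurable_component_singleton, simp)

lemma borel_measurable_placement_cost: "placement_cost n p \<in> borel_measurable (uniform_items n)"
proof -
  have "(\<lambda>x. \<bar>x (fst a) - x (snd a)\<bar>) \<in> borel_measurable (uniform_items n)"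
    if "a \<in> adjacent_items n p" for a
  proof -
    have [measurable]: "(\<lambda>x. x (fst a)) \<in> borel_measurable (uniform_items n)"
      "(\<lambda>x. x (snd a)) \<in> borel_measurable (uniform_items n)"
      using that by (auto simp: adjacent_items_def intro!: measurable_item)
    show ?thesis by measurable
  qed
  then show ?thesis
    unfolding placement_cost_def[abs_def] case_prod_beta by (rule borel_measurable_sum)
qed

lemma borel_measurable_offline_opt: "offline_opt n m \<in> borel_measurable (uniform_items n)"
  unfolding offline_opt_def[abs_def]
  by (intro borel_measurable_Min finite_placements borel_measurable_placement_cost)

lemma sets_hashes_eq:
  "{x\<in>space (uniform_items n). \<forall>i<n. hash m (x i) = g i} \<in> sets (uniform_items n)"
proof -
  have "{x\<in>space (uniform_items n). hash m (x i) = g i} \<in> sets (uniform_items n)" if "i < n" for i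
  proof -
    note [measurable] = measurable_item[OF that]
    show ?thesis by measurable
  qed
  then have "{x\<in>space (uniform_items n). \<forall>i\<in>{..<n}. hash m (x i) = g i} \<in> sets (uniform_items n)"
    by (intro sets.sets_Collect_finite_All) auto
  then show ?thesis by (simp only: Ball_def lessThan_iff)
qed

lemma borel_measurable_hashes_eq:
  "(\<lambda>x. of_bool (\<forall>i<n. hash m (x i) = g i) :: real) \<in> borel_measurable (uniform_items n)"
proof -
  have "(\<lambda>x. indicator {x\<in>space (uniform_items n). \<forall>i<n. hash m (x i) = g i} x :: real)
      \<in> borel_measurable (uniform_items n)"
    using sets_hashes_eq by simp
  then show ?thesis
    by (rule measurable_cong[THEN iffD1, rotated]) (simp add: indicator_def)
qed

lemma borel_measurable_online_cost_linear_probing: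
  assumes "m > 0"
  shows "online_cost (linear_probing m) n \<in> borel_measurable (uniform_items n)"
proof -
  \<comment> \<open>Where the hash function equals \<open>g\<close>, the placement is the fixed map
    \<open>slot m g\<close>.\<close>
  have "online_cost (linear_probing m) n = (\<lambda>x. \<Sum>g\<in>{..<n} \<rightarrow>\<^sub>E {..<m}.
      of_bool (\<forall>i<n. hash m (x i) = g i) * placement_cost n (slot m g) x)"
    by (simp add: fun_eq_iff online_cost_linear_probing sum_over_hashes[OF assms])
  also have "\<dots> \<in> borel_measurable (uniform_items n)"
    by (intro borel_measurable_sum borel_measurable_times borel_measurable_hashes_eq
        borel_measurable_placement_cost)
  finally show ?thesis .
qed

text \<open>By independence, it suffices that the preimage of a hash value lies in an interval of
  length \<open>1 / m\<close>. An upper bound is enough because only nonnegative functions of the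
  hashes will be integrated.\<close>

lemma prob_hashes_le:
  assumes "m > 0"
  shows "measure (uniform_items n) {x\<in>space (uniform_items n). \<forall>i<n. hash m (x i) = g i} \<le> 1 / real m ^ n"
proof -
  have "measure (uniform_items n) {x\<in>space (uniform_items n). \<forall>i<n. hash m (x i) = g i}
      = measure (uniform_items n) {x\<in>space (uniform_items n). \<forall>i<n. x i \<in> hash m -` {g i}}"
    by simp
  also have "\<dots> = (\<Prod>i<n. measure lborel ({0<..<1} \<inter> hash m -` {g i}))"
    using measurable_sets[OF measurable_hash] by (intro measure_uniform_items) simp
  also have "\<dots> \<le> (\<Prod>i<n. 1 / real m)"
  proof (rule prod_mono, rule conjI)
    fix i
    have sub: "{0<..<1} \<inter> hash m -` {g i} \<subseteq> {real (g i) / real m..(real (g i) + 1) / real m}"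
    proof
      fix t assume "t \<in> {0<..<1} \<inter> hash m -` {g i}"
      then have "real (g i) \<le> real m * t" "real m * t \<le> real (g i) + 1"
        using hash_bounds[of t m] assms by auto
      then show "t \<in> {real (g i) / real m..(real (g i) + 1) / real m}"
        using assms by (simp add: field_simps)
    qed
    have "measure lborel ({0<..<1} \<inter> hash m -` {g i})
        \<le> measure lborel {real (g i) / real m..(real (g i) + 1) / real m}"
      using sub measurable_sets[OF measurable_hash, of "{g i}" m]
      by (intro measure_mono_fmeasurable fmeasurableI) (auto simp: emeasure_lborel_Icc_eq)
    also have "\<dots> = 1 / real m"
      using assms by (simp add: field_simps)
    finally show "measure lborel ({0<..<1} \<inter> hash m -` {g i}) \<le> 1 / real m" .
  qed simp
  also have "\<dots> = 1 / real m ^ n"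
    by (simp add: power_one_over)
  finally show ?thesis .
qed

lemma integral_hashes_le:
  fixes F :: "(nat \<Rightarrow> nat) \<Rightarrow> real"
  assumes "m > 0" and "\<And>g. F g \<ge> 0"
  shows "integrable (uniform_items n) (\<lambda>x. F (hashes n m x))"
    and "(\<integral>x. F (hashes n m x) \<partial>uniform_items n) \<le> (\<Sum>g\<in>{..<n} \<rightarrow>\<^sub>E {..<m}. F g) / real m ^ n"
proof -
  interpret prob_space "uniform_items n" by (rule prob_space_uniform_items)
  let ?E = "\<lambda>g. {x\<in>space (uniform_items n). \<forall>i<n. hash m (x i) = g i}"
  have eq: "F (hashes n m x) = (\<Sum>g\<in>{..<n} \<rightarrow>\<^sub>E {..<m}. indicator (?E g) x * F g)"
    if "x \<in> space (uniform_items n)" for x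
    using sum_over_hashes[OF assms(1), of n x F] that by (simp add: indicator_def of_bool_def)
  have int: "integrable (uniform_items n) (\<lambda>x. indicator (?E g) x * F g)" for g
    using sets_hashes_eq by (intro integrable_mult_left) (auto simp: emeasure_eq_measure)
  show "integrable (uniform_items n) (\<lambda>x. F (hashes n m x))"
    by (subst Bochner_Integration.integrable_cong[OF refl eq]) (auto intro!: Bochner_Integration.integrable_sum int)
  have "(\<integral>x. F (hashes n m x) \<partial>uniform_items n)
      = (\<integral>x. (\<Sum>g\<in>{..<n} \<rightarrow>\<^sub>E {..<m}. indicator (?E g) x * F g) \<partial>uniform_items n)"
    by (rule Bochner_Integration.integral_cong[OF refl eq])
  also have "\<dots> = (\<Sum>g\<in>{..<n} \<rightarrow>\<^sub>E {..<m}. \<integral>x. indicator (?E g) x * F g \<partial>uniform_items n)"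
    by (rule Bochner_Integration.integral_sum) (rule int)
  also have "\<dots> = (\<Sum>g\<in>{..<n} \<rightarrow>\<^sub>E {..<m}. measure (uniform_items n) (?E g) * F g)"
    using sets_hashes_eq by (intro sum.cong) (auto simp: Int_absorb2 sets.sets_into_space)
  also have "\<dots> \<le> (\<Sum>g\<in>{..<n} \<rightarrow>\<^sub>E {..<m}. 1 / real m ^ n * F g)"
    by (intro sum_mono mult_right_mono prob_hashes_le assms)
  also have "\<dots> = (\<Sum>g\<in>{..<n} \<rightarrow>\<^sub>E {..<m}. F g) / real m ^ n"
    by (simp add: sum_divide_distrib)
  finally show "(\<integral>x. F (hashes n m x) \<partial>uniform_items n)
      \<le> (\<Sum>g\<in>{..<n} \<rightarrow>\<^sub>E {..<m}. F g) / real m ^ n" .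
qed

section \<open>Cost of linear probing on random items\<close>

lemma AE_online_cost_le:
  assumes "n < m"
  shows "AE x in uniform_items n. online_cost (linear_probing m) n x
    \<le> 2 + 4 * real (queue n (hashes n m x) m)
      + 2 / real m * (\<Sum>b<m. real (queue n (hashes n m x) b))"
  using AE_uniform_items
proof (rule AE_mp, intro AE_I2 impI)
  fix x :: "nat \<Rightarrow> real" assume x: "\<forall>i<n. 0 < x i \<and> x i < 1"
  have "m > 0" using assms by simp
  interpret probing n m "hashes n m x" "slot m (hashes n m x)"
    using assms by (intro probing_slot) (auto simp: hashes_def hash_less)
  show "online_cost (linear_probing m) n x
    \<le> 2 + 4 * real (queue n (hashes n m x) m)
      + 2 / real m * (\<Sum>b<m. real (queue n (hashes n m x) b))"
    unfolding online_cost_linear_probing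
    using x hash_bounds[OF _ _ \<open>m > 0\<close>]
    by (intro placement_cost_le) (auto simp: hashes_def less_imp_le)
qed

text \<open>The optimum is at least the spread of the items, and each of the at most
  \<open>n\<close> adjacent pairs costs at most the spread. This controls the ratio when the optimum
  is small.\<close>

lemma online_cost_le_mult_offline_opt:
  assumes "n \<le> m"
  shows "online_cost (linear_probing m) n x \<le> real n * offline_opt n m x"
proof -
  have "online_placement (linear_probing m) n x \<in> placements n m"
    using online_sorting_algorithm_linear_probing[OF assms] by (simp add: online_sorting_algorithm_def)
  then have ne: "placements n m \<noteq> {}" and inj: "inj_on (online_placement (linear_probing m) n x) {..<n}"
    by (auto simp: placements_def)
  show ?thesis
    unfolding online_cost_def
    by (intro placement_cost_le_mult inj abs_diff_le_offline_opt offline_opt_nonneg ne)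
qed

lemma AE_online_cost_le_size:
  "AE x in uniform_items n. online_cost (linear_probing m) n x \<le> real n"
  using AE_uniform_items
proof (rule AE_mp, intro AE_I2 impI)
  fix x :: "nat \<Rightarrow> real" assume x: "\<forall>i<n. 0 < x i \<and> x i < 1"
  have "\<bar>x i - x j\<bar> \<le> 1" if "i < n" "j < n" for i j
    using x[rule_format, OF that(1)] x[rule_format, OF that(2)] by auto
  then have "online_cost (linear_probing m) n x \<le> real n * 1"
    unfolding online_cost_linear_probing
    by (intro placement_cost_le_mult inj_on_subset[OF inj_slot]) auto
  then show "online_cost (linear_probing m) n x \<le> real n" by simp
qed

lemma expectation_online_cost_le:
  assumes "n < m"
  shows "integrable (uniform_items n) (online_cost (linear_probing m) n)"
    and "(\<integral>x. online_cost (linear_probing m) n x \<partial>uniform_items n) \<le> 6 + 3 / (1 - real n / real m)"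
proof -
  interpret prob_space "uniform_items n" by (rule prob_space_uniform_items)
  have "m > 0" using assms by simp
  show int: "integrable (uniform_items n) (online_cost (linear_probing m) n)"
    using AE_online_cost_le_size[where n = n and m = m] borel_measurable_online_cost_linear_probing[OF \<open>m > 0\<close>]
    by (intro integrable_const_bound[where B = "real n"])
      (auto simp: online_cost_def placement_cost_nonneg)
  define F where "F g = 2 + 4 * real (queue n g m) + 2 / real m * (\<Sum>b<m. real (queue n g b))" for g
  have F: "F g \<ge> 0" for g by (simp add: F_def sum_nonneg)
  have "(\<integral>x. online_cost (linear_probing m) n x \<partial>uniform_items n)
      \<le> (\<integral>x. F (hashes n m x) \<partial>uniform_items n)"
    using AE_online_cost_le[OF assms]
    by (intro integral_mono_AE int integral_hashes_le(1)[OF \<open>m > 0\<close> F]) (simp add: F_def)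
  also have "\<dots> \<le> (\<Sum>g\<in>{..<n} \<rightarrow>\<^sub>E {..<m}. F g) / real m ^ n"
    by (rule integral_hashes_le(2)[OF \<open>m > 0\<close> F])
  also have "\<dots> \<le> ((6 + 3 / (1 - real n / real m)) * real (card ({..<n} \<rightarrow>\<^sub>E {..<m}))) / real m ^ n"
    unfolding F_def by (intro divide_right_mono sum_cost_bound_le[OF assms]) simp
  also have "\<dots> = 6 + 3 / (1 - real n / real m)"
    using \<open>m > 0\<close> by (simp add: card_PiE)
  finally show "(\<integral>x. online_cost (linear_probing m) n x \<partial>uniform_items n)
      \<le> 6 + 3 / (1 - real n / real m)" .
qed

section \<open>The competitive ratio\<close>

definition concentrated :: "nat \<Rightarrow> (nat \<Rightarrow> real) set" where
  "concentrated n = {x\<in>space (uniform_items n). \<forall>i<n. x i \<in> {..<2/3}}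
    \<union> {x\<in>space (uniform_items n). \<forall>i<n. x i \<in> {1/3<..}}"

lemma sets_all_items_in:
  assumes "S \<in> sets borel"
  shows "{x\<in>space (uniform_items n). \<forall>i<n. x i \<in> S} \<in> sets (uniform_items n)"
proof -
  have "{x\<in>space (uniform_items n). x i \<in> S} \<in> sets (uniform_items n)" if "i < n" for i
    using measurable_sets[OF measurable_item[OF that] assms] by (simp add: vimage_def Int_def conj_commute)
  then have "{x\<in>space (uniform_items n). \<forall>i\<in>{..<n}. x i \<in> S} \<in> sets (uniform_items n)"
    by (intro sets.sets_Collect_finite_All) simp_all
  then show ?thesis by (simp only: Ball_def lessThan_iff)
qed

lemma sets_concentrated: "concentrated n \<in> sets (uniform_items n)"
  unfolding concentrated_def by (rule sets.Un; rule sets_all_items_in; simp)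

lemma prob_concentrated_le: "measure (uniform_items n) (concentrated n) \<le> 2 * (2/3) ^ n"
proof -
  interpret prob_space "uniform_items n" by (rule prob_space_uniform_items)
  have "measure (uniform_items n) (concentrated n)
      \<le> measure (uniform_items n) {x\<in>space (uniform_items n). \<forall>i<n. x i \<in> {..<2/3}}
        + measure (uniform_items n) {x\<in>space (uniform_items n). \<forall>i<n. x i \<in> {1/3<..}}"
    unfolding concentrated_def by (intro measure_Un_le sets_all_items_in) auto
  also have "\<dots> = (\<Prod>i<n. measure lborel ({0<..<1} \<inter> {..<2/3::real}))
      + (\<Prod>i<n. measure lborel ({0<..<1} \<inter> {1/3::real<..}))"
    by (intro arg_cong2[where f = "(+)"] measure_uniform_items) auto
  also have "{0<..<1} \<inter> {..<2/3} = {0<..<2/3::real}" by auto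
  also have "{0<..<1} \<inter> {1/3<..} = {1/3<..<1::real}" by auto
  finally show ?thesis by simp
qed

lemma offline_opt_ge_third:
  assumes "placements n m \<noteq> {}" and "x \<in> space (uniform_items n)" and "x \<notin> concentrated n"
  shows "offline_opt n m x \<ge> 1/3"
proof -
  obtain i j where ij: "i < n" "x i \<ge> 2/3" "j < n" "x j \<le> 1/3"
    using assms(2,3) by (auto simp: concentrated_def not_less)
  then have "1/3 \<le> \<bar>x i - x j\<bar>" by simp
  also have "\<dots> \<le> offline_opt n m x" by (rule abs_diff_le_offline_opt[OF assms(1) ij(1,3)])
  finally show ?thesis .
qed

text \<open>By Bernoulli's inequality \<open>(3/2) ^ n\<close> is at least \<open>n / 2\<close>.
  Hence the factor \<open>n\<close> lost on concentrated inputs contributes only a constant to the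
  expected ratio.\<close>

lemma mult_two_thirds_power_le: "real n * (2/3) ^ n \<le> 2"
proof -
  have "1 + real n * (1/2) \<le> (1 + 1/2) ^ n" by (rule Bernoulli_inequality) simp
  then have "real n * (2/3) ^ n \<le> 2 * (3/2) ^ n * (2/3) ^ n" by (intro mult_right_mono) auto
  also have "\<dots> = 2" by (simp add: power_mult_distrib[symmetric])
  finally show ?thesis .
qed

lemma expected_competitive_ratio_linear_probing:
  assumes "2 \<le> n" and "n < m"
  shows "expected_competitive_ratio_le n m (linear_probing m) (27 * (6 + 3 / (1 - real n / real m)))"
proof -
  interpret prob_space "uniform_items n" by (rule prob_space_uniform_items)
  let ?M = "uniform_items n" and ?cost = "online_cost (linear_probing m) n" and ?opt = "offline_opt n m"
  define K where "K = 6 + 3 / (1 - real n / real m)"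
  have "K \<ge> 6" using assms by (simp add: K_def)
  have placed: "online_placement (linear_probing m) n x \<in> placements n m" for x
    using online_sorting_algorithm_linear_probing[of n m] assms
    by (simp add: online_sorting_algorithm_def)
  then have ne: "placements n m \<noteq> {}" by auto
  have cost_nonneg: "?cost x \<ge> 0" for x by (simp add: online_cost_def placement_cost_nonneg)
  have opt_nonneg: "?opt x \<ge> 0" for x by (rule offline_opt_nonneg[OF ne])
  have cost_le: "?cost x \<le> real n * ?opt x" for x
    using assms by (intro online_cost_le_mult_offline_opt) simp
  note [measurable] = borel_measurable_offline_opt[of n m] sets_concentrated[of n]
    borel_measurable_online_cost_linear_probing[of m n, OF order.strict_trans1[OF le0 assms(2)]]
  have int_cost: "integrable ?M ?cost" and E_cost: "(\<integral>x. ?cost x \<partial>?M) \<le> K"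
    using expectation_online_cost_le[OF assms(2)] by (simp_all add: K_def)
  have int_opt: "integrable ?M ?opt"
  \<comment> \<open>The algorithm's own placement competes for the minimum, so its integrable cost
    dominates the optimum.\<close>
  proof (rule Bochner_Integration.integrable_bound[OF int_cost])
    show "AE x in ?M. norm (?opt x) \<le> norm (?cost x)"
      using offline_opt_le[OF placed] opt_nonneg cost_nonneg by (auto simp: online_cost_def)
  qed measurable
  have int_conc: "integrable ?M (\<lambda>x. indicator (concentrated n) x :: real)"
    by (auto simp: emeasure_eq_measure sets_concentrated)
  have ratio_le: "?cost x / ?opt x \<le> 3 * ?cost x + real n * indicator (concentrated n) x"
    if "x \<in> space ?M" for x
  proof (cases "?opt x \<ge> 1/3")
    case True
    then have "?cost x * 1 \<le> ?cost x * (3 * ?opt x)"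
      using cost_nonneg[of x] by (intro mult_left_mono) auto
    then have "?cost x / ?opt x \<le> 3 * ?cost x"
      using True by (simp add: divide_le_eq mult_ac)
    then show ?thesis by (simp add: add_increasing2)
  next
    case False
    with offline_opt_ge_third[OF ne that] have "x \<in> concentrated n" by auto
    \<comment> \<open>If the optimum is 0, the quotient is 0 by the convention for division.\<close>
    moreover have "?cost x / ?opt x \<le> real n"
      using cost_le[of x] opt_nonneg[of x] by (cases "?opt x = 0") (auto simp: divide_le_eq)
    ultimately show ?thesis using cost_nonneg[of x] by simp
  qed
  have int_bound: "integrable ?M (\<lambda>x. 3 * ?cost x + real n * indicator (concentrated n) x)"
    by (intro Bochner_Integration.integrable_add integrable_mult_right int_cost int_conc)
  have int_ratio: "integrable ?M (\<lambda>x. ?cost x / ?opt x)"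
  proof (rule Bochner_Integration.integrable_bound[OF int_bound])
    show "AE x in ?M. norm (?cost x / ?opt x)
        \<le> norm (3 * ?cost x + real n * indicator (concentrated n) x)"
      using ratio_le cost_nonneg opt_nonneg by (intro AE_I2) fastforce
  qed measurable
  have "(\<integral>x. ?cost x / ?opt x \<partial>?M)
      \<le> (\<integral>x. 3 * ?cost x + real n * indicator (concentrated n) x \<partial>?M)"
    by (rule integral_mono[OF int_ratio int_bound ratio_le])
  also have "\<dots> = 3 * (\<integral>x. ?cost x \<partial>?M) + real n * measure ?M (concentrated n)"
    using int_cost int_conc sets.sets_into_space[OF sets_concentrated[of n]]
    by (simp add: Int_absorb2)
  also have "\<dots> \<le> 3 * K + real n * (2 * (2/3) ^ n)"
    using E_cost prob_concentrated_le[of n] by (intro add_mono mult_left_mono) auto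
  \<comment> \<open>The concentrated inputs contribute at most 4, and
    \<open>3 * K + 4 \<le> 27 * K\<close>.\<close>
  also have "\<dots> \<le> 27 * K" using mult_two_thirds_power_le[of n] \<open>K \<ge> 6\<close> by simp
  finally have E_ratio: "(\<integral>x. ?cost x / ?opt x \<partial>?M) \<le> 27 * K" .
  \<comment> \<open>For \<open>n \<ge> 2\<close> the concentrated event has probability at most 8/9,
    so the optimum is at least 1/3 with probability at least 1/9. Its mean is then at least 1/27,
    which is the source of the factor 27.\<close>
  have "(2/3::real) ^ n \<le> (2/3) ^ 2" using assms(1) by (intro power_decreasing) auto
  then have "1/9 \<le> 1 - measure ?M (concentrated n)"
    using prob_concentrated_le[of n] by (simp add: power2_eq_square)
  then have "1/27 \<le> 1/3 * (1 - measure ?M (concentrated n))" by simp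
  also have "\<dots> = (\<integral>x. 1/3 * (1 - indicator (concentrated n) x) \<partial>?M)"
    using int_conc sets.sets_into_space[OF sets_concentrated[of n]]
    by (simp add: Int_absorb2 prob_space)
  also have "\<dots> \<le> (\<integral>x. ?opt x \<partial>?M)"
  proof (rule integral_mono)
    show "1/3 * (1 - indicator (concentrated n) x) \<le> ?opt x" if "x \<in> space ?M" for x
      using offline_opt_ge_third[OF ne that] opt_nonneg[of x] by (auto simp: indicator_def)
  qed (use int_opt int_conc in auto)
  finally have "27 * K * (1/27) \<le> 27 * K * (\<integral>x. ?opt x \<partial>?M)"
    using \<open>K \<ge> 6\<close> by (intro mult_left_mono) auto
  with E_cost have "(\<integral>x. ?cost x \<partial>?M) \<le> 27 * K * (\<integral>x. ?opt x \<partial>?M)" by simp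
  with int_cost int_opt int_ratio E_ratio show ?thesis
    unfolding expected_competitive_ratio_le_def K_def by blast
qed

section \<open>Inputs of at most one item, and the uniform constant\<close>

lemma expected_competitive_ratio_trivial:
  assumes "n \<le> 1" and "n \<le> m" and "R \<ge> 0"
  shows "expected_competitive_ratio_le n m A R"
proof -
  have "adjacent_items n p = {}" for p
  proof -
    have "(i, j) \<notin> adjacent_items n p" for i j
    proof
      assume "(i, j) \<in> adjacent_items n p"
      then have "i < n" "j < n" "p i < p j" by (auto simp: adjacent_items_def)
      moreover from this assms(1) have "i = j" by linarith
      ultimately show False by simp
    qed
    then show ?thesis by auto
  qed
  then have cost: "placement_cost n p x = 0" for p x by (simp add: placement_cost_def)
  have "restrict id {..<n} \<in> placements n m"
    using assms(2) by (auto simp: placements_def inj_on_def)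
  then have "(\<lambda>_. 0 :: real) ` placements n m = {0}" by blast
  then have "offline_opt n m = (\<lambda>_. 0)"
    by (simp add: offline_opt_def cost fun_eq_iff)
  moreover have "online_cost A n = (\<lambda>_. 0)"
    by (simp add: online_cost_def cost fun_eq_iff)
  ultimately show ?thesis
    using assms(3) by (simp add: expected_competitive_ratio_le_def)
qed

lemma expected_competitive_ratio_mono:
  assumes "expected_competitive_ratio_le n m A R" and "R \<le> R'" and "placements n m \<noteq> {}"
  shows "expected_competitive_ratio_le n m A R'"
proof -
  have "R * (\<integral>x. offline_opt n m x \<partial>uniform_items n) \<le> R' * (\<integral>x. offline_opt n m x \<partial>uniform_items n)"
    using assms(2) by (intro mult_right_mono integral_nonneg_AE) (auto simp: offline_opt_nonneg[OF assms(3)])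
  with assms(1,2) show ?thesis unfolding expected_competitive_ratio_le_def by auto
qed

theorem theorem6:
  "\<exists>C::real. C > 0 \<and>
     (\<forall>\<gamma>::real. \<gamma> > 1 \<longrightarrow>
        (\<exists>A :: nat \<Rightarrow> real list \<Rightarrow> nat. \<forall>n.
           online_sorting_algorithm n (nat \<lceil>\<gamma> * real n\<rceil>) (A n) \<and>
           expected_competitive_ratio_le n (nat \<lceil>\<gamma> * real n\<rceil>) (A n) (C * (1 + 1 / (\<gamma> - 1)))))"
proof -
  have main: "online_sorting_algorithm n m (linear_probing m) \<and>
      expected_competitive_ratio_le n m (linear_probing m) (243 * (1 + 1 / (\<gamma> - 1)))"
    if "\<gamma> > 1" and m: "m = nat \<lceil>\<gamma> * real n\<rceil>" for \<gamma> n m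
  proof -
    have \<gamma>n_le_m: "\<gamma> * real n \<le> real m" unfolding m by (rule real_nat_ceiling_ge)
    have "real n \<le> \<gamma> * real n" using \<open>\<gamma> > 1\<close> by (simp add: mult_le_cancel_right1)
    with \<gamma>n_le_m have "n \<le> m" by linarith
    then have alg: "online_sorting_algorithm n m (linear_probing m)"
      by (rule online_sorting_algorithm_linear_probing)
    moreover have "expected_competitive_ratio_le n m (linear_probing m) (243 * (1 + 1 / (\<gamma> - 1)))"
    proof (cases "n \<le> 1")
      case True
      with \<open>n \<le> m\<close> \<open>\<gamma> > 1\<close> show ?thesis by (intro expected_competitive_ratio_trivial) auto
    next
      case False
      then have "real n < \<gamma> * real n" using \<open>\<gamma> > 1\<close> by simp
      with \<gamma>n_le_m have "n < m" by linarith
      \<comment> \<open>Since \<open>m \<ge> \<gamma> * n\<close>, the load factor is at most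
        \<open>1 / \<gamma>\<close>, and
        \<open>1 / (1 - 1 / \<gamma>) = 1 + 1 / (\<gamma> - 1)\<close>.\<close>
      have "real n / real m \<le> 1 / \<gamma>"
        using \<gamma>n_le_m \<open>\<gamma> > 1\<close> \<open>n < m\<close> by (simp add: field_simps)
      then have "3 / (1 - real n / real m) \<le> 3 / (1 - 1 / \<gamma>)"
        using \<open>\<gamma> > 1\<close> \<open>n < m\<close> by (intro divide_left_mono mult_pos_pos) auto
      also have "\<dots> = 3 * (1 + 1 / (\<gamma> - 1))" using \<open>\<gamma> > 1\<close> by (simp add: field_simps)
      finally have "3 / (1 - real n / real m) \<le> 3 * (1 + 1 / (\<gamma> - 1))" .
      moreover have "1 \<le> 1 + 1 / (\<gamma> - 1)" using \<open>\<gamma> > 1\<close> by simp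
      \<comment> \<open>With \<open>t = 1 + 1 / (\<gamma> - 1) \<ge> 1\<close>,
        \<open>6 + 3 * t \<le> 9 * t\<close>, and \<open>27 * 9 = 243\<close>.\<close>
      moreover have "27 * (6 + a) \<le> 243 * t" if "a \<le> 3 * t" "1 \<le> t" for a t :: real
        using that by simp
      ultimately have "27 * (6 + 3 / (1 - real n / real m)) \<le> 243 * (1 + 1 / (\<gamma> - 1))"
        by blast
      moreover have "placements n m \<noteq> {}"
        using alg by (auto simp: online_sorting_algorithm_def)
      ultimately show ?thesis
        using expected_competitive_ratio_linear_probing[of n m] False \<open>n < m\<close>
        by (auto intro: expected_competitive_ratio_mono)
    qed
    ultimately show ?thesis by blast
  qed
  show ?thesis
  proof (intro exI[of _ "243::real"] conjI allI impI)
    fix \<gamma> :: real assume "\<gamma> > 1"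
    then show "\<exists>A :: nat \<Rightarrow> real list \<Rightarrow> nat. \<forall>n.
           online_sorting_algorithm n (nat \<lceil>\<gamma> * real n\<rceil>) (A n) \<and>
           expected_competitive_ratio_le n (nat \<lceil>\<gamma> * real n\<rceil>) (A n) (243 * (1 + 1 / (\<gamma> - 1)))"
      using main by (intro exI[of _ "\<lambda>n. linear_probing (nat \<lceil>\<gamma> * real n\<rceil>)"]) simp
  qed simp
qed

end
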